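(* For all $n\in\mathbb{N}_0$, $\mu(n)\leq 3f\left(\frac{n}{3}\right)$.
   Context: $\mathbb{N}_0=\{0,1,2,\ldots\}$. Let $T\subseteq\mathbb{N}_0^2$ be the additive monoid consisting of all finite linear combinations with coefficients in $\mathbb{N}_0$ of the vectors $z_i=\left(i,\binom{i}{2}\right)$, $i\in\mathbb{N}_0$, where $\binom{i}{2}=\frac{i(i-1)}{2}$. For $n\in\mathbb{N}_0$, $\mu(n):=\min\{m\in\mathbb{N}_0 : (m,n)\in T\}$. The function $f$ is given by $f(x)=\frac{1+\sqrt{8x+1}}{2}$ for real $x\geq 0$. *)

theory Defs
  imports Complex_Main "HOL-Library.Product_Plus"
begin

definition zvec :: "nat \<Rightarrow> nat \<times> nat" where
  "zvec i = (i, i choose 2)"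

text \<open>The sum below is taken in the componentwise additive monoid on pairs;
  a scalar coefficient acts on both components.\<close>

definition T :: "(nat \<times> nat) set" where
  "T = {p. \<exists>(I :: nat set) (c :: nat \<Rightarrow> nat). finite I \<and>
           p = (\<Sum>i\<in>I. (c i * fst (zvec i), c i * snd (zvec i)))}"

definition mu :: "nat \<Rightarrow> nat" where
  "mu n = (LEAST m. (m, n) \<in> T)"

text \<open>Only the values at \<open>x \<ge> 0\<close> are meaningful.\<close>

definition f :: "real \<Rightarrow> real" where
  "f x = (1 + sqrt (8 * x + 1)) / 2"

text \<open>The set minimised over in \<open>mu\<close> is never empty, so the minimum exists.\<close>

lemma two_mult_in_T: "(2 * n, n) \<in> T"
  unfolding T_def zvec_def
  by (rule CollectI, rule exI[of _ "{2}"], rule exI[of _ "\<lambda>_. n"]) simp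

lemma mu_in_T: "(mu n, n) \<in> T"
  unfolding mu_def by (rule LeastI, rule two_mult_in_T)

lemma mu_le: "(m, n) \<in> T \<Longrightarrow> mu n \<le> m"
  unfolding mu_def by (rule Least_le)

end

theory Submission
  imports Defs
begin

text \<open>
  For \<open>m \<ge> 0\<close> the bound \<open>m \<le> 3 f (n / 3)\<close> means \<open>m\<^sup>2 \<le> 6 n + 3 m\<close>. A number \<open>m\<close> with
  \<open>(m, n) \<in> T\<close> satisfying it is found by strong induction: subtract from \<open>n\<close> the largest
  \<open>i choose 2\<close>, leaving \<open>r < i\<close>. The inequality for \<open>m'\<close> and \<open>r\<close> passes to \<open>i + m'\<close> and \<open>n\<close>
  as soon as \<open>m' \<le> i\<close>, which is automatic for \<open>i \<ge> 7\<close>. This leaves \<open>n < 21\<close>, where \<open>n\<close> is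
  visibly a sum of three triangular numbers, and Cauchy--Schwarz gives the inequality.
\<close>

lemma zvec_in_T: "zvec i \<in> T"
  unfolding T_def by (rule CollectI, rule exI[of _ "{i}"], rule exI[of _ "\<lambda>_. 1"]) simp

text \<open>Both combinations are rewritten over the union of their index sets, extending each
  coefficient function by 0, and are then added termwise.\<close>

lemma T_add:
  assumes "p \<in> T" "q \<in> T"
  shows "p + q \<in> T"
proof -
  let ?s = "\<lambda>c i. (c i * fst (zvec i), c i * snd (zvec i))"
  have extend: "sum (?s c) I = sum (?s (\<lambda>i. if i \<in> I then c i else 0)) K"
    if "finite K" "I \<subseteq> K" for I K :: "nat set" and c :: "nat \<Rightarrow> nat"
    using that by (intro sum.mono_neutral_cong_left) (auto simp: zero_prod_def)
  from assms obtain I c J d where I: "finite I" "p = sum (?s c) I" and J: "finite J" "q = sum (?s d) J"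
    unfolding T_def by auto
  let ?e = "\<lambda>i. (if i \<in> I then c i else 0) + (if i \<in> J then d i else 0)"
  have "p + q = sum (?s ?e) (I \<union> J)"
    using I J extend[of "I \<union> J" I c] extend[of "I \<union> J" J d]
    by (simp add: sum.distrib[symmetric] distrib_right)
  then show ?thesis
    unfolding T_def using I(1) J(1) by (intro CollectI exI[of _ "I \<union> J"] exI[of _ ?e]) simp
qed

lemma twice_choose_two: "2 * (i choose 2) + i = i * i"
  by (induction i) (simp_all add: numeral_2_eq_2)

text \<open>Induction on \<open>n\<close>: once the remainder would reach \<open>i\<close>, Pascal's
  rule turns \<open>(i choose 2) + i\<close> into \<open>Suc i choose 2\<close> and resets it to
  0.\<close>

lemma triangular_decomposition: "\<exists>i r. n = (i choose 2) + r \<and> r < i"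
proof (induction n)
  case 0
  show ?case by (intro exI[of _ 1] exI[of _ 0]) simp
next
  case (Suc n)
  then obtain i r where n: "n = (i choose 2) + r" and "r < i" by blast
  then consider "Suc r < i" | "Suc r = i" by linarith
  then show ?case
  proof cases
    case 1
    then show ?thesis using n by (intro exI[of _ i] exI[of _ "Suc r"]) simp
  next
    case 2
    then show ?thesis using n
      by (intro exI[of _ "Suc i"] exI[of _ 0]) (simp add: numeral_2_eq_2)
  qed
qed

text \<open>A finite check; since \<open>7 choose 2\<close> is 21, only indices below 7 can occur up
  to repetition of the values 0 and 1.\<close>

lemma three_triangular_small:
  fixes n :: nat
  assumes "n < 21"
  shows "\<exists>i j k. n = (i choose 2) + (j choose 2) + (k choose 2)"
proof -
  have "\<forall>n\<in>set [0..<21]. \<exists>i\<in>set [0..<7]. \<exists>j\<in>set [0..<7]. \<exists>k\<in>set [0..<7].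
          n = (i choose 2) + (j choose 2) + (k choose 2)"
    by code_simp
  with assms show ?thesis by (metis atLeastLessThan_iff set_upt zero_le)
qed

text \<open>The difference of the two sides is the sum of the squares of the pairwise differences,
  hence the passage to \<open>int\<close>.\<close>

lemma three_squares_ge:
  fixes i j k :: nat
  shows "(i + j + k)\<^sup>2 \<le> 3 * (i * i + j * j + k * k)"
proof -
  have "(int i + int j + int k)\<^sup>2 \<le> 3 * (int i * int i + int j * int j + int k * int k)"
    using zero_le_power2[of "int i - int j"] zero_le_power2[of "int j - int k"]
      zero_le_power2[of "int i - int k"]
    by (simp add: power2_eq_square algebra_simps)
  then have "int ((i + j + k)\<^sup>2) \<le> int (3 * (i * i + j * j + k * k))" by simp
  then show ?thesis by linarith
qed

lemma T_quadratic_bound: "\<exists>m. (m, n) \<in> T \<and> m * m \<le> 6 * n + 3 * m"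
proof (induction n rule: less_induct)
  case (less n)
  show ?case
  proof (cases "n < 21")
    case True
    then obtain i j k where n: "n = (i choose 2) + (j choose 2) + (k choose 2)"
      using three_triangular_small by blast
    have "zvec i + zvec j + zvec k \<in> T" by (intro T_add zvec_in_T)
    then have "(i + j + k, n) \<in> T" by (simp add: zvec_def n)
    \<comment> \<open>The squares of \<open>i\<close>, \<open>j\<close>, \<open>k\<close> add up to
      \<open>2 * n + (i + j + k)\<close>.\<close>
    moreover have "(i + j + k) * (i + j + k) \<le> 6 * n + 3 * (i + j + k)"
      using three_squares_ge[of i j k] twice_choose_two[of i] twice_choose_two[of j]
        twice_choose_two[of k] n
      by (simp add: power2_eq_square)
    ultimately show ?thesis by blast
  next
    case False
    obtain i r where n: "n = (i choose 2) + r" and r: "r < i"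
      using triangular_decomposition by blast
    \<comment> \<open>For \<open>i \<le> 6\<close> and \<open>r < i\<close> the sum is at most 15 +
      5 = 20.\<close>
    have i7: "7 \<le> i"
    proof (rule ccontr)
      assume "\<not> 7 \<le> i"
      then have "i * i \<le> 6 * i" by (intro mult_right_mono) auto
      with twice_choose_two[of i] n r False \<open>\<not> 7 \<le> i\<close> show False by linarith
    qed
    then have "0 < i choose 2" by (simp add: zero_less_binomial)
    with n have "r < n" by simp
    then obtain m where m: "(m, r) \<in> T" "m * m \<le> 6 * r + 3 * m"
      using less.IH by blast
    \<comment> \<open>Otherwise \<open>m * (m - 3) \<ge> (i + 1) * (i - 2)\<close>, which exceeds
      \<open>6 * (i - 1) \<ge> 6 * r\<close> for \<open>i \<ge> 7\<close>. Writing
      \<open>i = 7 + e\<close> and \<open>m = i + 1 + d\<close> leaves only nonnegative terms to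
      compare.\<close>
    have "m \<le> i"
    proof (rule ccontr)
      assume "\<not> m \<le> i"
      then obtain d where d: "m = i + 1 + d" using less_imp_Suc_add[of i m] by auto
      obtain e where e: "i = 7 + e" using i7 le_Suc_ex by blast
      show False using m(2) r unfolding d e by (simp add: algebra_simps)
    qed
    \<comment> \<open>So \<open>i * i + 2 * (i * m)\<close> is at most \<open>3 * (i * i)\<close>,
      which equals \<open>6 * (i choose 2) + 3 * i\<close>.\<close>
    then have "i * m \<le> i * i" by simp
    then have "i * i + 2 * (i * m) + m * m \<le> 6 * n + 3 * i + 3 * m"
      using m(2) twice_choose_two[of i] n by linarith
    then have "(i + m) * (i + m) \<le> 6 * n + 3 * (i + m)" by (simp add: algebra_simps)
    moreover have "zvec i + (m, r) \<in> T" using zvec_in_T m(1) by (rule T_add)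
    then have "(i + m, n) \<in> T" by (simp add: zvec_def n)
    ultimately show ?thesis by blast
  qed
qed

theorem theorem6p5:
  fixes n :: nat
  shows "real (mu n) \<le> 3 * f (real n / 3)"
proof -
  obtain m where m: "(m, n) \<in> T" "m * m \<le> 6 * n + 3 * m"
    using T_quadratic_bound by blast
  have "real m * real m \<le> 6 * real n + 3 * real m"
    using m(2) by (metis (mono_tags) of_nat_add of_nat_le_iff of_nat_mult of_nat_numeral)
  \<comment> \<open>Completing the square, scaled so that the argument of the root in
    \<open>f (n / 3)\<close> appears.\<close>
  then have "((2 * real m - 3) / 3)\<^sup>2 \<le> 8 * (real n / 3) + 1"
    by (simp add: power2_eq_square field_simps)
  then have "(2 * real m - 3) / 3 \<le> sqrt (8 * (real n / 3) + 1)"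
    by (rule real_le_rsqrt)
  then have "real m \<le> 3 * f (real n / 3)" by (simp add: f_def field_simps)
  with mu_le[OF m(1)] show ?thesis by linarith
qed

end
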